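(* Let $\Gamma$ be a countable discrete group and $\nu$ a probability measure on $\Gamma$ with $\nu(e)>0$. Let $T\in\mathcal B(\ell^2(\Gamma))$ satisfy $\mathcal P_\nu(\mathcal P^o_\nu(T))=T$. Then $\mathcal P_\nu(T)=T$ and $\mathcal P^o_\nu(T)=T$. In particular, if $\nu$ is moreover symmetric and generating, then $T$ lies in the center of the group von Neumann algebra $L(\Gamma)$.
   Context: $\lambda$ and $\rho$ denote the left and right regular representations of $\Gamma$ on $\ell^2(\Gamma)$: $\lambda_g\delta_x=\delta_{gx}$, $\rho_g\delta_x=\delta_{xg^{-1}}$. Define the normal ucp maps on $\mathcal B(\ell^2(\Gamma))$: $\mathcal P_\nu(T)=\sum_g\nu(g)\rho_gT\rho_g^*$ and $\mathcal P^o_\nu(T)=\sum_g\nu(g)\lambda_g^*T\lambda_g$ (so that on multiplication operators $\mathcal P_\nu(M_f)=M_{f*\nu}$ and $\mathcal P^o_\nu(M_f)=M_{\nu*f}$, where $(f*\nu)(g)=\sum_h\nu(h)f(gh)$, $(\nu*f)(g)=\sum_h\nu(h)f(hg)$). $L(\Gamma)$ is the von Neumann algebra generated by $\{\lambda_g\}$. $\nu$ is symmetric if $\nu(g)=\nu(g^{-1})$ and generating if its support generates $\Gamma$ as a group. *)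

theory Defs
  imports "HOL-Analysis.Analysis" "HOL-Library.Countable"
begin

text \<open>Concrete model of B(l^2(Gamma)): an operator T is represented by its matrix
  T x y = <delta_x, T delta_y>, so that (T f)(x) = sum_y T x y * f y.
  The group Gamma is written additively (type class group_add, not necessarily
  commutative); the neutral element is 0, and g x is written g + x.\<close>

definition l2 :: "('g \<Rightarrow> complex) \<Rightarrow> bool" where
  "l2 f \<longleftrightarrow> (\<lambda>x. (cmod (f x))\<^sup>2) summable_on UNIV"

definition l2norm_sq :: "('g \<Rightarrow> complex) \<Rightarrow> real" where
  "l2norm_sq f = (\<Sum>\<^sub>\<infinity>x. (cmod (f x))\<^sup>2)"

text \<open>A kernel defines a bounded operator on l^2 iff it is bounded on the dense subspace of
  finitely supported functions.\<close>
definition bounded_kernel :: "('g \<Rightarrow> 'g \<Rightarrow> complex) \<Rightarrow> bool" where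
  "bounded_kernel T \<longleftrightarrow> (\<exists>C. \<forall>f :: 'g \<Rightarrow> complex. finite {y. f y \<noteq> 0} \<longrightarrow>
      (\<lambda>x. (cmod (\<Sum>y\<in>{y. f y \<noteq> 0}. T x y * f y))\<^sup>2) summable_on UNIV \<and>
      (\<Sum>\<^sub>\<infinity>x. (cmod (\<Sum>y\<in>{y. f y \<noteq> 0}. T x y * f y))\<^sup>2) \<le> C * l2norm_sq f)"

text \<open>Composition of operators (matrix product; absolutely convergent for bounded kernels).\<close>
definition kcomp :: "('g \<Rightarrow> 'g \<Rightarrow> complex) \<Rightarrow> ('g \<Rightarrow> 'g \<Rightarrow> complex) \<Rightarrow> ('g \<Rightarrow> 'g \<Rightarrow> complex)" where
  "kcomp S T = (\<lambda>x z. \<Sum>\<^sub>\<infinity>y. S x y * T y z)"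

definition lambda_op :: "'g::group_add \<Rightarrow> ('g \<Rightarrow> 'g \<Rightarrow> complex)" where
  "lambda_op g = (\<lambda>x y. if x = g + y then 1 else 0)"

definition rho_op :: "'g::group_add \<Rightarrow> ('g \<Rightarrow> 'g \<Rightarrow> complex)" where
  "rho_op g = (\<lambda>x y. if x = y - g then 1 else 0)"

text \<open>P_nu(T) = sum_g nu(g) rho_g T rho_g^*, whose (x,y) matrix entry is
  sum_g nu(g) T(xg, yg).\<close>
definition P_nu :: "('g::group_add \<Rightarrow> real) \<Rightarrow> ('g \<Rightarrow> 'g \<Rightarrow> complex) \<Rightarrow> ('g \<Rightarrow> 'g \<Rightarrow> complex)" where
  "P_nu \<nu> T = (\<lambda>x y. \<Sum>\<^sub>\<infinity>g. complex_of_real (\<nu> g) * T (x + g) (y + g))"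

text \<open>P^o_nu(T) = sum_g nu(g) lambda_g^* T lambda_g, whose (x,y) matrix entry is
  sum_g nu(g) T(gx, gy).\<close>
definition Po_nu :: "('g::group_add \<Rightarrow> real) \<Rightarrow> ('g \<Rightarrow> 'g \<Rightarrow> complex) \<Rightarrow> ('g \<Rightarrow> 'g \<Rightarrow> complex)" where
  "Po_nu \<nu> T = (\<lambda>x y. \<Sum>\<^sub>\<infinity>g. complex_of_real (\<nu> g) * T (g + x) (g + y))"

definition commutant :: "('g \<Rightarrow> 'g \<Rightarrow> complex) set \<Rightarrow> ('g \<Rightarrow> 'g \<Rightarrow> complex) set" where
  "commutant S = {T. bounded_kernel T \<and> (\<forall>A\<in>S. kcomp T A = kcomp A T)}"

text \<open>Group von Neumann algebra L(Gamma): the von Neumann algebra generated by the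
  lambda_g, i.e. (bicommutant theorem) the bicommutant of {lambda_g}.\<close>
definition group_vNa :: "('g::group_add \<Rightarrow> 'g \<Rightarrow> complex) set" where
  "group_vNa = commutant (commutant (range lambda_op))"

definition center :: "('g \<Rightarrow> 'g \<Rightarrow> complex) set \<Rightarrow> ('g \<Rightarrow> 'g \<Rightarrow> complex) set" where
  "center M = {T\<in>M. \<forall>A\<in>M. kcomp T A = kcomp A T}"

definition prob_measure_on :: "('g \<Rightarrow> real) \<Rightarrow> bool" where
  "prob_measure_on \<nu> \<longleftrightarrow> (\<forall>g. 0 \<le> \<nu> g) \<and> (\<nu> has_sum 1) UNIV"

definition symmetric_measure :: "('g::group_add \<Rightarrow> real) \<Rightarrow> bool" where
  "symmetric_measure \<nu> \<longleftrightarrow> (\<forall>g. \<nu> g = \<nu> (- g))"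

definition subgroup_generated :: "'g::group_add set \<Rightarrow> 'g set" where
  "subgroup_generated S = \<Inter>{H. 0 \<in> H \<and> S \<subseteq> H \<and> (\<forall>a\<in>H. \<forall>b\<in>H. a + b \<in> H) \<and> (\<forall>a\<in>H. - a \<in> H)}"

definition generating_measure :: "('g::group_add \<Rightarrow> real) \<Rightarrow> bool" where
  "generating_measure \<nu> \<longleftrightarrow> subgroup_generated {g. \<nu> g \<noteq> 0} = UNIV"

end

theory Submission
  imports Defs
begin

text \<open>Write \<open>P\<close> and \<open>P\<^sup>o\<close> for the two averaging operators. They commute, and \<open>P P\<^sup>o T = T\<close>
  forces \<open>P T = T\<close> by a maximum principle on matrix entries: at a point where \<open>P T - T\<close> is almost
  extremal, all \<open>P\<^sup>k (P T - T)\<close> are almost extremal because \<open>\<nu> 0 > 0\<close>, yet their sums telescope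
  to something bounded.

  For the second part, the columnwise variance \<open>D\<close> of the translates \<open>\<rho>\<^sub>g T \<rho>\<^sub>g\<^sup>*\<close> equals \<open>P F - F\<close>
  where \<open>F y = \<parallel>T \<delta>\<^sub>y\<parallel>\<^sup>2\<close>, and \<open>D\<close> is subharmonic for \<open>P\<^sup>o\<close> since each \<open>\<rho>\<^sub>g T \<rho>\<^sub>g\<^sup>* - T\<close> is
  \<open>P\<^sup>o\<close>-harmonic. The left and the right random walk have the same law when started at the neutral
  element, so \<open>(P\<^sup>o)\<^sup>n D\<close> at the neutral element is an increment of a bounded sequence while
  increasing in \<open>n\<close>; hence \<open>D = 0\<close> and \<open>T\<close> is invariant under right translation. Then \<open>F\<close> is
  constant, so the left variance vanishes too. A kernel invariant under both translations is
  convolution with a class function, which lies in the center of \<open>L(\<Gamma>)\<close>.\<close>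

section \<open>Weighted means of bounded families\<close>

lemma has_sum_diff:
  fixes f g :: "'a \<Rightarrow> real"
  assumes "(f has_sum a) A" "(g has_sum b) A"
  shows "((\<lambda>x. f x - g x) has_sum a - b) A"
  using has_sum_add[OF assms(1) has_sum_uminusI[OF assms(2)]] by simp

locale prob_weights =
  fixes \<nu> :: "'i \<Rightarrow> real"
  assumes prob: "prob_measure_on \<nu>"
begin

definition mean :: "('i \<Rightarrow> 'b::banach) \<Rightarrow> 'b" where
  "mean f = (\<Sum>\<^sub>\<infinity>i. \<nu> i *\<^sub>R f i)"

lemma weight_nonneg: "0 \<le> \<nu> i"
  and weights_has_sum: "(\<nu> has_sum 1) UNIV"
  using prob by (auto simp: prob_measure_on_def)

lemma weight_summable: "\<nu> summable_on UNIV"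
  by (rule has_sum_imp_summable[OF weights_has_sum])

lemma mean_abs_summable:
  fixes f :: "'i \<Rightarrow> 'b::banach"
  assumes "bounded (range f)"
  shows "(\<lambda>i. norm (\<nu> i *\<^sub>R f i)) summable_on UNIV"
proof -
  obtain C where "\<And>i. norm (f i) \<le> C"
    using assms by (auto simp: bounded_iff)
  then have "norm (\<nu> i *\<^sub>R f i) \<le> \<nu> i * C" for i
    by (simp add: weight_nonneg mult_left_mono)
  then show ?thesis
    by (rule Infinite_Sum.abs_summable_on_comparison_test'[OF summable_on_cmult_left[OF weight_summable]])
qed

lemma mean_has_sum:
  fixes f :: "'i \<Rightarrow> 'b::banach"
  assumes "bounded (range f)"
  shows "((\<lambda>i. \<nu> i *\<^sub>R f i) has_sum mean f) UNIV"
  unfolding mean_def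
  by (rule has_sum_infsum[OF Infinite_Sum.abs_summable_summable[OF mean_abs_summable[OF assms]]])

lemma mean_const [simp]: "mean (\<lambda>_. c) = c"
proof -
  have "((\<lambda>i. \<nu> i *\<^sub>R c) has_sum 1 *\<^sub>R c) UNIV"
    using has_sum_bounded_linear[OF bounded_linear_scaleR_left weights_has_sum] .
  then show ?thesis
    unfolding mean_def by (simp add: infsumI)
qed

lemma mean_add:
  assumes "bounded (range f)" "bounded (range g)"
  shows "mean (\<lambda>i. f i + g i) = mean f + mean g"
proof -
  have "((\<lambda>i. \<nu> i *\<^sub>R (f i + g i)) has_sum (mean f + mean g)) UNIV"
    using has_sum_add[OF mean_has_sum[OF assms(1)] mean_has_sum[OF assms(2)]]
    by (simp add: scaleR_add_right)
  then show ?thesis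
    unfolding mean_def[of "\<lambda>i. f i + g i"] by (simp add: infsumI)
qed

lemma mean_bounded_linear:
  assumes "bounded_linear h" "bounded (range f)"
  shows "mean (\<lambda>i. h (f i)) = h (mean f)"
proof -
  interpret bounded_linear h by fact
  have "((\<lambda>i. \<nu> i *\<^sub>R h (f i)) has_sum h (mean f)) UNIV"
    using has_sum_bounded_linear[OF assms(1) mean_has_sum[OF assms(2)]] by (simp add: scaleR)
  then show ?thesis
    unfolding mean_def[of "\<lambda>i. h (f i)"] by (simp add: infsumI)
qed

lemma mean_diff:
  assumes "bounded (range f)" "bounded (range g)"
  shows "mean (\<lambda>i. f i - g i) = mean f - mean g"
proof -
  have "bounded (range (\<lambda>i. - g i))"
    using assms(2) by (simp add: bounded_iff)
  then show ?thesis
    using mean_add[OF assms(1), of "\<lambda>i. - g i"]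
      mean_bounded_linear[OF bounded_linear_minus[OF bounded_linear_ident] assms(2)] by simp
qed

lemma mean_mono:
  fixes f :: "'i \<Rightarrow> real"
  assumes "bounded (range f)" "bounded (range g)" "\<And>i. f i \<le> g i"
  shows "mean f \<le> mean g"
  by (rule has_sum_mono[OF mean_has_sum[OF assms(1)] mean_has_sum[OF assms(2)]])
    (simp add: assms(3) weight_nonneg mult_left_mono)

lemma mean_le:
  fixes f :: "'i \<Rightarrow> real"
  assumes "bounded (range f)" "\<And>i. f i \<le> c"
  shows "mean f \<le> c"
  using mean_mono[OF assms(1), of "\<lambda>_. c"] assms(2) by simp

lemma mean_nonneg:
  fixes f :: "'i \<Rightarrow> real"
  assumes "\<And>i. 0 \<le> f i"
  shows "0 \<le> mean f"
  unfolding mean_def by (rule infsum_nonneg) (simp add: assms weight_nonneg)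

lemma norm_mean_le:
  assumes "\<And>i. norm (f i) \<le> C"
  shows "norm (mean f) \<le> C"
proof -
  have b: "bounded (range f)"
    using assms by (auto simp: bounded_iff)
  have "norm (mean f) \<le> mean (\<lambda>i. norm (f i))"
    using norm_infsum_bound[OF mean_abs_summable[OF b]]
    by (simp add: mean_def weight_nonneg)
  also have "\<dots> \<le> C"
    using b by (intro mean_le assms) (auto simp: bounded_iff)
  finally show ?thesis .
qed

text \<open>Keeping only the term \<open>k\<close> of the nonnegative family \<open>s - f\<close>
  bounds \<open>s - mean f\<close> below by \<open>\<nu> k * (s - f k)\<close>: the weight at
  \<open>k\<close> turns a nearly maximal mean into a nearly maximal value
  \<open>f k\<close>.\<close>

lemma mean_le_convex:
  fixes f :: "'i \<Rightarrow> real"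
  assumes "bounded (range f)" "\<And>i. f i \<le> s"
  shows "mean f \<le> \<nu> k * f k + (1 - \<nu> k) * s"
proof -
  have b: "bounded (range (\<lambda>i. s - f i))"
    using assms(1) bounded_minus_comp[of "\<lambda>_. s" UNIV f] by simp
  have "\<nu> k *\<^sub>R (s - f k) \<le> mean (\<lambda>i. s - f i)"
    by (rule has_sum_mono2[OF has_sum_finiteI mean_has_sum[OF b], of "{k}"])
      (auto simp: assms(2) weight_nonneg)
  also have "\<dots> = s - mean f"
    using assms(1) by (subst mean_diff) auto
  finally show ?thesis
    by (simp add: algebra_simps)
qed

lemma mean_eq_0D:
  fixes f :: "'i \<Rightarrow> real"
  assumes "bounded (range f)" "\<And>i. 0 \<le> f i" "mean f = 0" "\<nu> k \<noteq> 0"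
  shows "f k = 0"
proof -
  have "\<nu> k *\<^sub>R f k = 0"
    by (rule nonneg_infsum_le_0D[where A = UNIV])
      (use assms mean_abs_summable[OF assms(1)] weight_nonneg
        in \<open>auto simp: mean_def Infinite_Sum.abs_summable_summable\<close>)
  then show ?thesis
    using assms(4) by simp
qed

text \<open>Fubini: the inner sums of norms are \<open>\<nu> i\<close> times means bounded by
  \<open>C\<close>, so the double family is absolutely summable.\<close>

lemma mean_swap:
  fixes f :: "'i \<Rightarrow> 'i \<Rightarrow> 'b::banach"
  assumes "\<And>i j. norm (f i j) \<le> C"
  shows "mean (\<lambda>i. mean (f i)) = mean (\<lambda>j. mean (\<lambda>i. f i j))"
proof -
  have bd: "bounded (range (f i))" "bounded (range (\<lambda>i. f i j))" for i j
    using assms by (auto simp: bounded_iff)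
  have m: "(\<Sum>\<^sub>\<infinity>j. norm (\<nu> i *\<^sub>R \<nu> j *\<^sub>R f i j)) = \<nu> i *\<^sub>R mean (\<lambda>j. norm (f i j))" for i
    unfolding mean_def by (simp add: infsum_cmult_right' weight_nonneg mult.assoc)
  have "(\<lambda>p. norm (case p of (i, j) \<Rightarrow> \<nu> i *\<^sub>R \<nu> j *\<^sub>R f i j)) summable_on UNIV \<times> UNIV"
  proof (subst Infinite_Sum.abs_summable_on_Sigma_iff, intro conjI ballI)
    show "(\<lambda>j. norm (case (i, j) of (i, j) \<Rightarrow> \<nu> i *\<^sub>R \<nu> j *\<^sub>R f i j)) summable_on UNIV" for i
      using summable_on_cmult_right[OF mean_abs_summable[OF bd(1)], of "\<bar>\<nu> i\<bar>", of i]
      by (simp add: abs_mult mult_ac)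
    have "norm (mean (\<lambda>j. norm (f i j))) \<le> C" for i
      by (rule norm_mean_le) (simp add: assms)
    then have "bounded (range (\<lambda>i. mean (\<lambda>j. norm (f i j))))"
      by (auto simp: bounded_iff)
    then show "(\<lambda>i. norm (\<Sum>\<^sub>\<infinity>j. norm (case (i, j) of (i, j) \<Rightarrow> \<nu> i *\<^sub>R \<nu> j *\<^sub>R f i j)))
        summable_on UNIV"
      using mean_abs_summable[where f = "\<lambda>i. mean (\<lambda>j. norm (f i j))"] m by (simp add: abs_mult)
  qed
  then have "(\<Sum>\<^sub>\<infinity>i. \<Sum>\<^sub>\<infinity>j. \<nu> i *\<^sub>R \<nu> j *\<^sub>R f i j) = (\<Sum>\<^sub>\<infinity>j. \<Sum>\<^sub>\<infinity>i. \<nu> i *\<^sub>R \<nu> j *\<^sub>R f i j)"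
    by (rule infsum_swap_banach[OF Infinite_Sum.abs_summable_summable])
  then show ?thesis
    unfolding mean_def by (simp add: mult.commute flip: infsum_scaleR_right)
qed

lemma mean_variance:
  fixes f :: "'i \<Rightarrow> complex"
  assumes "bounded (range f)"
  shows "mean (\<lambda>i. (cmod (f i - mean f))\<^sup>2) = mean (\<lambda>i. (cmod (f i))\<^sup>2) - (cmod (mean f))\<^sup>2"
proof -
  define m where "m = mean f"
  obtain C where C: "\<And>i. cmod (f i) \<le> C"
    using assms by (auto simp: bounded_iff)
  have b1: "bounded (range (\<lambda>i. (cmod (f i))\<^sup>2))"
    using C by (auto simp: bounded_iff intro!: exI[of _ "C\<^sup>2"] power_mono)
  \<comment> \<open>The cross term as a real-linear functional of \<open>f i\<close>, so that
    \<open>mean_bounded_linear\<close> evaluates its mean.\<close>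
  define h where "h z = 2 * Re (z * cnj m)" for z
  have bl: "bounded_linear h"
    unfolding h_def by (intro bounded_linear_const_mult bounded_linear_mult_const
        bounded_linear_compose[OF bounded_linear_Re]) auto
  have b2: "bounded (range (\<lambda>i. h (f i)))"
    using bounded_linear_image[OF assms bl] by (simp add: image_image)
  have "(cmod (f i - m))\<^sup>2 = ((cmod (f i))\<^sup>2 - h (f i)) + (cmod m)\<^sup>2" for i
    unfolding cmod_power2 h_def by (simp add: algebra_simps power2_eq_square)
  then have "mean (\<lambda>i. (cmod (f i - m))\<^sup>2) = mean (\<lambda>i. (cmod (f i))\<^sup>2) - h m + (cmod m)\<^sup>2"
    using bounded_minus_comp[OF b1 b2]
    by (simp add: mean_add mean_diff[OF b1 b2] mean_bounded_linear[OF bl assms] m_def)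
  also have "h m = 2 * (cmod m)\<^sup>2"
    unfolding cmod_power2 h_def by (simp add: power2_eq_square)
  finally show ?thesis
    by (simp add: m_def)
qed

section \<open>Averaging operators\<close>

text \<open>The Markov operator of the random walk that moves \<open>p\<close> to
  \<open>\<phi> i p\<close> with probability \<open>\<nu> i\<close>. An arbitrary state space lets
  it serve both group elements and index pairs of matrices.\<close>

definition avg :: "('i \<Rightarrow> 'a \<Rightarrow> 'a) \<Rightarrow> ('a \<Rightarrow> 'b::banach) \<Rightarrow> 'a \<Rightarrow> 'b" where
  "avg \<phi> f p = mean (\<lambda>i. f (\<phi> i p))"

lemma bounded_range_comp:
  assumes "\<And>p. norm (f p) \<le> C"
  shows "bounded (range (\<lambda>i. f (g i)))"
  using assms by (auto simp: bounded_iff)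

lemma norm_avg_le:
  assumes "\<And>p. norm (f p) \<le> C"
  shows "norm (avg \<phi> f p) \<le> C"
  unfolding avg_def by (rule norm_mean_le) (rule assms)

lemma norm_avg_power_le:
  assumes "\<And>p. norm (f p) \<le> C"
  shows "norm ((avg \<phi> ^^ n) f p) \<le> C"
  by (induction n arbitrary: p) (simp_all add: assms norm_avg_le)

lemma avg_diff:
  assumes "\<And>p. norm (f p) \<le> C" "\<And>p. norm (g p) \<le> C'"
  shows "avg \<phi> (\<lambda>p. f p - g p) p = avg \<phi> f p - avg \<phi> g p"
  unfolding avg_def
  using assms by (intro mean_diff bounded_range_comp) auto

section \<open>Commuting averages and the maximum principle\<close>

lemma avg_commute:
  assumes "\<And>p. norm (f p) \<le> C" "\<And>i j p. \<phi> i (\<psi> j p) = \<psi> j (\<phi> i p)"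
  shows "avg \<phi> (avg \<psi> f) = avg \<psi> (avg \<phi> f)"
proof
  show "avg \<phi> (avg \<psi> f) p = avg \<psi> (avg \<phi> f) p" for p
    unfolding avg_def using mean_swap[of "\<lambda>i j. f (\<psi> j (\<phi> i p))" C] by (simp add: assms)
qed

lemma avg_power_commute:
  assumes "\<And>p. norm (f p) \<le> C" "\<And>i j p. \<phi> i (\<psi> j p) = \<psi> j (\<phi> i p)"
  shows "avg \<psi> ((avg \<phi> ^^ n) f) = (avg \<phi> ^^ n) (avg \<psi> f)"
proof (induction n)
  case (Suc n)
  have "avg \<psi> (avg \<phi> ((avg \<phi> ^^ n) f)) = avg \<phi> (avg \<psi> ((avg \<phi> ^^ n) f))"
    using avg_commute[where f = "(avg \<phi> ^^ n) f" and \<phi> = \<phi> and \<psi> = \<psi>,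
        OF norm_avg_power_le[where f = f and \<phi> = \<phi>, OF assms(1)] assms(2)] by simp
  then show ?case
    using Suc by simp
qed simp

text \<open>With \<open>c n = (avg \<phi> ^^ n) f\<close> and \<open>u n = c (n + 1) - c n\<close> one has \<open>avg \<psi> (u (n + 1)) = u n\<close>.
  Since \<open>\<psi> k\<close> is trivial and \<open>\<nu> k > 0\<close>, a point at which \<open>u 0\<close> almost attains its supremum \<open>s\<close>
  is almost extremal for \<open>u 0, \<dots>, u n\<close> as well; were \<open>s > 0\<close>, the telescoping sum of these
  would exceed the bound on \<open>c n - c 0\<close>.\<close>
lemma avg_le_if_fixed_by_product:
  fixes f :: "'a \<Rightarrow> real"
  assumes bd: "\<And>p. \<bar>f p\<bar> \<le> C"
    and comm: "\<And>i j p. \<phi> i (\<psi> j p) = \<psi> j (\<phi> i p)"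
    and k: "\<And>p. \<psi> k p = p" "\<nu> k > 0"
    and fixed: "avg \<phi> (avg \<psi> f) = f"
  shows "avg \<phi> f p \<le> f p"
proof -
  define c where "c n = (avg \<phi> ^^ n) f" for n
  define u where "u n p = c (Suc n) p - c n p" for n p
  define s where "s = (SUP p. u 0 p)"
  have bd': "norm (f p) \<le> C" for p
    using bd by simp
  have c_bd: "norm (c n p) \<le> C" for n p
    unfolding c_def by (rule norm_avg_power_le) (rule bd')
  have c_Suc: "avg \<phi> (c n) = c (Suc n)" for n
    by (simp add: c_def)
  have "avg \<psi> (avg \<phi> f) = f"
    using fixed avg_commute[where f = f and \<phi> = \<phi> and \<psi> = \<psi>, OF bd' comm] by simp
  then have \<psi>_c: "avg \<psi> (c (Suc n)) = c n" for n
    using avg_power_commute[where f = "avg \<phi> f" and n = n and \<phi> = \<phi> and \<psi> = \<psi>,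
        OF norm_avg_le[where f = f, OF bd'] comm]
    unfolding c_def by (simp add: funpow_swap1)
  have u_bd: "norm (u n p) \<le> 2 * C" for n p
    using c_bd[of n p] c_bd[of "Suc n" p] unfolding u_def by simp
  have \<phi>_u: "avg \<phi> (u n) p = u (Suc n) p" for n p
    unfolding u_def using avg_diff[where f = "c (Suc n)" and g = "c n", OF c_bd c_bd] c_Suc by simp
  have \<psi>_u: "avg \<psi> (u (Suc n)) p = u n p" for n p
    unfolding u_def
    using avg_diff[where f = "c (Suc (Suc n))" and g = "c (Suc n)", OF c_bd c_bd] \<psi>_c by simp
  have bdd: "bdd_above (range (u 0))"
    using u_bd[of 0] by (auto intro!: bdd_aboveI[of _ "2 * C"] simp: abs_le_iff)
  have u_le: "u n p \<le> s" for n p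
  proof (induction n arbitrary: p)
    case 0
    then show ?case
      unfolding s_def by (rule cSUP_upper[OF _ bdd]) simp
  next
    case (Suc n)
    have "avg \<phi> (u n) p \<le> s"
      unfolding avg_def by (rule mean_le[OF bounded_range_comp[OF u_bd]]) (rule Suc)
    then show ?case
      by (simp add: \<phi>_u)
  qed
  \<comment> \<open>Isolating the index \<open>k\<close> in \<open>avg \<psi> (u (Suc n)) p\<close>
    shows that the deficit \<open>s - u n p\<close> grows by at most the factor
    \<open>1 / \<nu> k\<close> per step.\<close>
  have near: "\<nu> k ^ n * (s - u n p) \<le> s - u 0 p" for n p
  proof (induction n)
    case (Suc n)
    have "avg \<psi> (u (Suc n)) p \<le> \<nu> k * u (Suc n) (\<psi> k p) + (1 - \<nu> k) * s"
      unfolding avg_def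
      by (rule mean_le_convex[OF bounded_range_comp[OF u_bd]]) (rule u_le)
    then have "\<nu> k * (s - u (Suc n) p) \<le> s - u n p"
      by (simp add: \<psi>_u k algebra_simps)
    then have "\<nu> k ^ n * (\<nu> k * (s - u (Suc n) p)) \<le> \<nu> k ^ n * (s - u n p)"
      using k by (intro mult_left_mono) auto
    then show ?case
      using Suc by (simp add: mult_ac)
  qed simp
  have k1: "\<nu> k \<le> 1"
    by (rule has_sum_mono2[OF has_sum_finiteI weights_has_sum, of "{k}"]) (auto simp: weight_nonneg)
  have "s \<le> 0"
  proof (rule ccontr)
    assume "\<not> s \<le> 0"
    \<comment> \<open>\<open>n\<close> is fixed before \<open>q\<close>: the tolerance
      \<open>\<nu> k ^ n * (s / 2)\<close> used to select \<open>q\<close> keeps the first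
      \<open>n\<close> terms at \<open>q\<close> at least \<open>s / 2\<close>, so their sum exceeds
      \<open>2 * C\<close>.\<close>
    then obtain n :: nat where n: "2 * C < n * (s / 2)"
      using reals_Archimedean3[of "s / 2"] by (auto simp del: times_divide_eq_right)
    have "s - \<nu> k ^ n * (s / 2) < s"
      using \<open>\<not> s \<le> 0\<close> k by simp
    then obtain q where q: "s - \<nu> k ^ n * (s / 2) < u 0 q"
      using less_cSUP_iff[OF _ bdd] unfolding s_def by blast
    have "s / 2 \<le> u m q" if "m < n" for m
    proof -
      have "\<nu> k ^ n * (s - u m q) \<le> \<nu> k ^ m * (s - u m q)"
        using that k k1 u_le[of m q] by (intro mult_right_mono power_decreasing) auto
      also have "\<dots> \<le> \<nu> k ^ n * (s / 2)"
        using near[of m q] q by linarith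
      finally have "s - u m q \<le> s / 2"
        using k by simp
      then show ?thesis
        by simp
    qed
    then have "n * (s / 2) \<le> (\<Sum>m<n. u m q)"
      using sum_mono[of "{..<n}" "\<lambda>_. s / 2" "\<lambda>m. u m q"] by simp
    also have "\<dots> = c n q - c 0 q"
      unfolding u_def by (rule sum_lessThan_telescope)
    also have "\<dots> \<le> 2 * C"
      using c_bd[of n q] c_bd[of 0 q] by simp
    finally show False
      using n by simp
  qed
  then show ?thesis
    using u_le[of 0 p] by (simp add: u_def c_def)
qed

text \<open>\<open>Re\<close>, \<open>Im\<close> and their negatives commute with averages, so the
  one-sided real inequality applies to each component in both directions. The claim for
  \<open>\<psi>\<close> then follows by commuting the two averages.\<close>

lemma avg_fixed_if_fixed_by_product:
  fixes f :: "'a \<Rightarrow> complex"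
  assumes bd: "\<And>p. cmod (f p) \<le> C"
    and comm: "\<And>i j p. \<phi> i (\<psi> j p) = \<psi> j (\<phi> i p)"
    and k: "\<And>p. \<psi> k p = p" "\<nu> k > 0"
    and fixed: "avg \<phi> (avg \<psi> f) = f"
  shows "avg \<phi> f = f" "avg \<psi> f = f"
proof -
  have le: "h (avg \<phi> f p) \<le> h (f p)" if h: "bounded_linear h" for h :: "complex \<Rightarrow> real" and p
  proof -
    obtain B where B: "\<And>z. norm (h z) \<le> norm z * B" "B \<ge> 0"
      using bounded_linear.nonneg_bounded[OF h] by blast
    have avg_h: "avg \<theta> (\<lambda>p. h (g p)) = (\<lambda>q. h (avg \<theta> g q))"
      if "\<And>p. cmod (g p) \<le> C" for g :: "'a \<Rightarrow> complex" and \<theta> :: "'i \<Rightarrow> 'a \<Rightarrow> 'a"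
      unfolding avg_def[abs_def]
      by (intro ext, rule mean_bounded_linear[OF h bounded_range_comp[where f = g, OF that]])
    have "avg \<phi> (avg \<psi> (\<lambda>p. h (f p))) = (\<lambda>p. h (f p))"
      using avg_h[of f, OF bd]
        avg_h[of "avg \<psi> f", OF norm_avg_le[where f = f, OF bd]] fixed
      by simp
    moreover have "\<bar>h (f p)\<bar> \<le> C * B" for p
      using order_trans[OF B(1) mult_right_mono[OF bd B(2)]] by simp
    ultimately show ?thesis
      using avg_le_if_fixed_by_product[of "\<lambda>p. h (f p)" "C * B" \<phi> \<psi> k p] comm k avg_h[of f, OF bd]
      by simp
  qed
  show \<phi>_f: "avg \<phi> f = f"
  proof
    fix p
    show "avg \<phi> f p = f p"
      using le[OF bounded_linear_Re, of p] le[OF bounded_linear_minus[OF bounded_linear_Re], of p]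
        le[OF bounded_linear_Im, of p] le[OF bounded_linear_minus[OF bounded_linear_Im], of p]
      by (simp add: complex_eq_iff)
  qed
  show "avg \<psi> f = f"
    using avg_commute[where f = f and \<phi> = \<phi> and \<psi> = \<psi>, OF bd comm] \<phi>_f fixed by simp
qed

text \<open>At \<open>e\<close> the outermost average may be switched from \<open>\<phi>\<close> to
  \<open>\<psi>\<close>; commutation then moves it inside, next to \<open>f\<close>. The induction
  therefore varies \<open>f\<close>.\<close>

lemma avg_power_eq_at_base:
  assumes bd: "\<And>p. norm (f p) \<le> C"
    and comm: "\<And>i j p. \<phi> i (\<psi> j p) = \<psi> j (\<phi> i p)"
    and base: "\<And>i. \<phi> i e = \<psi> i e"
  shows "(avg \<phi> ^^ n) f e = (avg \<psi> ^^ n) f e"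
  using bd
proof (induction n arbitrary: f)
  case (Suc n)
  have "(avg \<phi> ^^ Suc n) f e = avg \<psi> ((avg \<phi> ^^ n) f) e"
    by (simp add: avg_def base)
  also have "avg \<psi> ((avg \<phi> ^^ n) f) = (avg \<phi> ^^ n) (avg \<psi> f)"
    by (rule avg_power_commute[where C = C]) (use Suc.prems comm in auto)
  also have "\<dots> e = (avg \<psi> ^^ n) (avg \<psi> f) e"
    by (rule Suc.IH) (rule norm_avg_le[OF Suc.prems])
  finally show ?case
    by (simp add: funpow_swap1)
qed simp

lemma avg_power_mono:
  fixes f g :: "'a \<Rightarrow> real"
  assumes "\<And>p. norm (f p) \<le> C" "\<And>p. norm (g p) \<le> C'" "\<And>p. f p \<le> g p"
  shows "(avg \<phi> ^^ n) f p \<le> (avg \<phi> ^^ n) g p"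
proof (induction n arbitrary: p)
  case (Suc n)
  have "avg \<phi> ((avg \<phi> ^^ n) f) p \<le> avg \<phi> ((avg \<phi> ^^ n) g) p"
    unfolding avg_def[of \<phi> _ p]
    by (intro mean_mono Suc bounded_range_comp) (rule norm_avg_power_le assms)+
  then show ?case
    by simp
qed (simp add: assms)

text \<open>The values \<open>(avg \<phi> ^^ n) D e = (avg \<psi> ^^ n) D e\<close> increase with \<open>n\<close>, while their sum
  telescopes to a bounded quantity.\<close>
lemma avg_power_defect_eq_0:
  fixes F :: "'a \<Rightarrow> real"
  assumes bd: "\<And>p. \<bar>F p\<bar> \<le> C"
    and comm: "\<And>i j p. \<phi> i (\<psi> j p) = \<psi> j (\<phi> i p)"
    and base: "\<And>i. \<phi> i e = \<psi> i e"
    and D: "\<And>p. D p = avg \<phi> F p - F p" "\<And>p. 0 \<le> D p" "\<And>p. D p \<le> avg \<psi> D p"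
  shows "(avg \<psi> ^^ j) D e = 0"
proof -
  define c where "c n = (avg \<phi> ^^ n) F" for n
  have c_bd: "norm (c n p) \<le> C" for n p
    unfolding c_def by (rule norm_avg_power_le) (use bd in simp)
  have D_bd: "norm (D p) \<le> 2 * C" for p
    using c_bd[of "Suc 0" p] c_bd[of 0 p] by (simp add: D(1) c_def)
  have "c (Suc n) p - c n p = (avg \<phi> ^^ n) D p" for n p
  proof (induction n arbitrary: p)
    case (Suc n)
    have "(avg \<phi> ^^ Suc n) D p = avg \<phi> (\<lambda>p. c (Suc n) p - c n p) p"
      by (simp add: Suc[abs_def])
    also have "\<dots> = c (Suc (Suc n)) p - c (Suc n) p"
      using avg_diff[where f = "c (Suc n)" and g = "c n", OF c_bd c_bd] by (simp add: c_def)
    finally show ?case ..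
  qed (simp add: c_def D(1))
  then have c_diff: "c (Suc n) e - c n e = (avg \<psi> ^^ n) D e" for n
    using avg_power_eq_at_base[where f = D and \<phi> = \<phi> and \<psi> = \<psi>, OF D_bd comm base] by simp
  have "(avg \<psi> ^^ n) D e \<le> (avg \<psi> ^^ n) (avg \<psi> D) e" for n
    by (rule avg_power_mono[OF D_bd norm_avg_le[where f = D, OF D_bd] D(3)])
  then have step: "(avg \<psi> ^^ n) D e \<le> (avg \<psi> ^^ Suc n) D e" for n
    by (simp add: funpow_swap1)
  have mono: "(avg \<psi> ^^ j) D e \<le> (avg \<psi> ^^ (m + j)) D e" for m
  proof (induction m)
    case (Suc m)
    then show ?case
      using step[of "m + j"] by simp
  qed simp
  have "n * (avg \<psi> ^^ j) D e \<le> 2 * C" for n :: nat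
  proof -
    have "n * (avg \<psi> ^^ j) D e \<le> (\<Sum>m<n. c (Suc m + j) e - c (m + j) e)"
      using sum_mono[of "{..<n}" "\<lambda>_. (avg \<psi> ^^ j) D e" "\<lambda>m. c (Suc m + j) e - c (m + j) e"]
        mono c_diff by simp
    also have "\<dots> = c (n + j) e - c (0 + j) e"
      by (rule sum_lessThan_telescope)
    also have "\<dots> \<le> 2 * C"
      using c_bd[of "n + j" e] c_bd[of j e] by simp
    finally show ?thesis .
  qed
  then have "(avg \<psi> ^^ j) D e \<le> 0"
    using reals_Archimedean3[of "(avg \<psi> ^^ j) D e"] by (metis not_le)
  moreover have "0 \<le> (avg \<psi> ^^ j) D e"
  proof (induction j arbitrary: e)
    case (Suc j)
    then show ?case
      by (simp add: avg_def mean_nonneg)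
  qed (simp add: D(2))
  ultimately show ?thesis
    by simp
qed

text \<open>Tonelli for nonnegative terms: the bijection \<open>\<alpha> i\<close> permutes rows, so
  the translate by \<open>\<alpha> i\<close> has sum \<open>F (\<alpha> i y)\<close> in column
  \<open>y\<close>. With squared moduli as \<open>K\<close>, averages of entries become averages of
  squared column norms.\<close>

lemma weighted_column_sums:
  fixes K :: "'a \<times> 'a \<Rightarrow> real"
  assumes nonneg: "\<And>p. 0 \<le> K p"
    and sums: "\<And>y. ((\<lambda>x. K (x, y)) has_sum F y) UNIV"
    and bd: "\<And>y. F y \<le> C"
    and bij: "\<And>i. bij (\<alpha> i)"
  shows "((\<lambda>x. avg (\<lambda>i. map_prod (\<alpha> i) (\<alpha> i)) K (x, y)) has_sum avg \<alpha> F y) UNIV"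
proof -
  have F_nonneg: "0 \<le> F y" for y
    using has_sum_nonneg[OF sums] nonneg by blast
  have F_bd: "norm (F y) \<le> C" for y
    using F_nonneg bd by simp
  have K_le: "norm (K p) \<le> C" for p
  proof -
    have "K (fst p, snd p) \<le> F (snd p)"
      using has_sum_mono2[OF has_sum_finiteI[of "{fst p}"] sums[of "snd p"]] nonneg by simp
    then show ?thesis
      using bd[of "snd p"] nonneg[of p] by simp
  qed
  let ?G = "\<lambda>(i, x). \<nu> i * K (\<alpha> i x, \<alpha> i y)"
  have 1: "((\<lambda>x. ?G (i, x)) has_sum \<nu> i * F (\<alpha> i y)) UNIV" for i
    using has_sum_cmult_right[OF has_sum_reindex_bij_betw[OF bij, THEN iffD2, OF sums]]
    by simp
  have 2: "((\<lambda>i. \<nu> i * F (\<alpha> i y)) has_sum avg \<alpha> F y) UNIV"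
    using mean_has_sum[OF bounded_range_comp[where f = F, OF F_bd]] unfolding avg_def by simp
  have "?G summable_on UNIV \<times> UNIV"
    by (rule summable_on_SigmaI[OF 1 has_sum_imp_summable[OF 2]])
      (simp add: weight_nonneg nonneg)
  then have "(?G has_sum avg \<alpha> F y) (UNIV \<times> UNIV)"
    by (rule has_sum_SigmaI[OF 1 2])
  then have "((\<lambda>(x, i). ?G (i, x)) has_sum avg \<alpha> F y) (UNIV \<times> UNIV)"
    by (rule has_sum_swap[THEN iffD1])
  then show ?thesis
  proof (rule has_sum_SigmaD)
    fix x
    show "((\<lambda>i. case (x, i) of (x, i) \<Rightarrow> ?G (i, x)) has_sum
        avg (\<lambda>i. map_prod (\<alpha> i) (\<alpha> i)) K (x, y)) UNIV"
      using mean_has_sum[OF bounded_range_comp[where f = K, OF K_le]]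
      unfolding avg_def by simp
  qed
qed

text \<open>Harmonicity at \<open>p\<close> makes \<open>t p\<close> the mean in
  \<open>mean_variance\<close>. As a variance is nonnegative, the squared modulus of a harmonic
  function is subharmonic.\<close>

lemma avg_variance:
  fixes t :: "'a \<Rightarrow> complex"
  assumes "\<And>p. cmod (t p) \<le> B" "avg \<phi> t p = t p"
  shows "mean (\<lambda>i. (cmod (t (\<phi> i p) - t p))\<^sup>2) = avg \<phi> (\<lambda>p. (cmod (t p))\<^sup>2) p - (cmod (t p))\<^sup>2"
  using mean_variance[OF bounded_range_comp[where f = t, OF assms(1)], of "\<lambda>i. \<phi> i p"] assms(2)
  unfolding avg_def by simp

end

section \<open>Bi-harmonic kernels\<close>

lemma subgroup_generated_UNIV_induct:
  assumes "subgroup_generated S = UNIV"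
    and "P 0" "\<And>g. g \<in> S \<Longrightarrow> P g" "\<And>g h. P g \<Longrightarrow> P h \<Longrightarrow> P (g + h)" "\<And>g. P g \<Longrightarrow> P (- g)"
  shows "P g"
proof -
  have "g \<in> subgroup_generated S"
    by (simp add: assms(1))
  then have "g \<in> Collect P"
    unfolding subgroup_generated_def by (rule InterD) (use assms(2-5) in auto)
  then show ?thesis
    by simp
qed

locale group_prob_weights = prob_weights \<nu> for \<nu> :: "'g::group_add \<Rightarrow> real"
begin

definition rtrans :: "'g \<Rightarrow> 'g \<Rightarrow> 'g" where
  "rtrans g x = x + g"

text \<open>Conjugating \<open>T\<close> by \<open>rho_op g\<close> replaces its entry at
  \<open>p\<close> by the one at \<open>rtrans2 g p\<close>; \<open>ltrans2\<close> plays this role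
  for conjugation by the adjoint of \<open>lambda_op g\<close>.\<close>

definition rtrans2 :: "'g \<Rightarrow> 'g \<times> 'g \<Rightarrow> 'g \<times> 'g" where
  "rtrans2 g = map_prod (rtrans g) (rtrans g)"

definition ltrans2 :: "'g \<Rightarrow> 'g \<times> 'g \<Rightarrow> 'g \<times> 'g" where
  "ltrans2 g = map_prod ((+) g) ((+) g)"

lemma bij_rtrans: "bij (rtrans g)"
  by (rule bij_betwI[of _ _ _ "\<lambda>x. x - g"]) (auto simp: rtrans_def)

lemma bij_ltrans: "bij ((+) g)" for g :: 'g
  by (rule bij_betwI[of _ _ _ "\<lambda>x. - g + x"]) (auto simp: add.assoc[symmetric])

lemma trans_commute: "rtrans g (h + x) = h + rtrans g x"
  by (simp add: rtrans_def add.assoc)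

lemma trans2_commute: "rtrans2 g (ltrans2 h p) = ltrans2 h (rtrans2 g p)"
  by (cases p) (simp add: rtrans2_def ltrans2_def trans_commute)

text \<open>Down a column the entrywise variances are nonnegative and sum to
  \<open>avg \<alpha> F y - F y = 0\<close>, so each vanishes; a step of nonzero weight then cannot
  change \<open>t\<close>.\<close>

lemma invariant_if_column_sums_harmonic:
  fixes t :: "'g \<times> 'g \<Rightarrow> complex"
  assumes bd: "\<And>p. cmod (t p) \<le> B"
    and sums: "\<And>y. ((\<lambda>x. (cmod (t (x, y)))\<^sup>2) has_sum F y) UNIV" "\<And>y. F y \<le> C"
    and bij: "\<And>i. bij (\<alpha> i)"
    and fixed: "avg (\<lambda>i. map_prod (\<alpha> i) (\<alpha> i)) t = t" "\<And>y. avg \<alpha> F y = F y"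
    and g: "\<nu> g \<noteq> 0"
  shows "t (\<alpha> g x, \<alpha> g y) = t (x, y)"
proof -
  let ?\<phi> = "\<lambda>i. map_prod (\<alpha> i) (\<alpha> i)"
  let ?K = "\<lambda>p. (cmod (t p))\<^sup>2"
  have var: "mean (\<lambda>i. (cmod (t (?\<phi> i p) - t p))\<^sup>2) = avg ?\<phi> ?K p - ?K p" for p
    by (rule avg_variance[OF bd]) (simp add: fixed)
  have "((\<lambda>x. avg ?\<phi> ?K (x, y) - ?K (x, y)) has_sum avg \<alpha> F y - F y) UNIV"
    using weighted_column_sums[of ?K F C \<alpha> y] sums bij 
    by (intro has_sum_diff) auto
  then have "avg ?\<phi> ?K (x, y) - ?K (x, y) = 0"
    by (rule nonneg_has_sum_le_0D) (auto simp: fixed mean_nonneg simp flip: var)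
  then have 0: "mean (\<lambda>i. (cmod (t (?\<phi> i (x, y)) - t (x, y)))\<^sup>2) = 0"
    unfolding var .
  have "cmod (t (?\<phi> i (x, y)) - t (x, y)) \<le> 2 * B" for i
    using norm_triangle_le_diff[of "t (?\<phi> i (x, y))" "t (x, y)" "2 * B"] bd[of "?\<phi> i (x, y)"] bd[of "(x, y)"]
    by linarith
  then have "bounded (range (\<lambda>i. (cmod (t (?\<phi> i (x, y)) - t (x, y)))\<^sup>2))"
    by (auto simp: bounded_iff intro!: exI[of _ "(2 * B)\<^sup>2"] power_mono)
  from mean_eq_0D[OF this _ 0 g] show ?thesis
    by simp
qed

text \<open>At the neutral element the vanishing comes from \<open>avg_power_defect_eq_0\<close>;
  symmetry and generation then carry it to every \<open>y\<close>.\<close>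

lemma right_defect_eq_0:
  fixes t :: "'g \<times> 'g \<Rightarrow> complex"
  assumes bd: "\<And>p. cmod (t p) \<le> B"
    and sums: "\<And>y. ((\<lambda>x. (cmod (t (x, y)))\<^sup>2) has_sum F y) UNIV" "\<And>y. F y \<le> C"
    and fixed: "avg rtrans2 t = t" "avg ltrans2 t = t"
    and gen: "symmetric_measure \<nu>" "generating_measure \<nu>"
  shows "avg rtrans F y = F y"
proof -
  let ?K = "\<lambda>p. (cmod (t p))\<^sup>2"
  define V where "V p = avg rtrans2 ?K p - ?K p" for p
  define D where "D y = avg rtrans F y - F y" for y
  have F_nonneg: "0 \<le> F y" for y
    using has_sum_nonneg[OF sums(1)] by simp
  have F_bd: "norm (F y) \<le> C" for y
    using F_nonneg sums(2) by simp
  have V_eq: "V p = mean (\<lambda>g. (cmod (t (rtrans2 g p) - t p))\<^sup>2)" for p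
    unfolding V_def by (rule avg_variance[symmetric, OF bd]) (simp add: fixed)
  have V_nonneg: "0 \<le> V p" for p
    unfolding V_eq by (rule mean_nonneg) simp
  have V_sum: "((\<lambda>x. V (x, y)) has_sum D y) UNIV" for y
    unfolding V_def D_def rtrans2_def[abs_def]
    using weighted_column_sums[of ?K F C rtrans y] sums bij_rtrans by (intro has_sum_diff) auto
  have D_nonneg: "0 \<le> D y" for y
    using has_sum_nonneg[OF V_sum] V_nonneg by blast
  have D_le: "D y \<le> C" for y
    using norm_avg_le[where f = F, OF F_bd, of rtrans y] F_nonneg[of y] unfolding D_def by simp
  have V_sub: "V p \<le> avg ltrans2 V p" for p
  proof -
    \<comment> \<open>Each \<open>w g\<close> is \<open>ltrans2\<close>-harmonic because left and
      right translations commute, so its squared modulus is subharmonic; averaging over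
      \<open>g\<close> and swapping the means gives the claim for \<open>V\<close>.\<close>
    define w where "w g q = t (rtrans2 g q) - t q" for g q
    have w_bd: "cmod (w g q) \<le> 2 * B" for g q
      using norm_triangle_le_diff[of "t (rtrans2 g q)" "t q" "2 * B"] bd[of "rtrans2 g q"] bd[of q]
      unfolding w_def by linarith
    have w2_bd: "norm ((cmod (w g q))\<^sup>2) \<le> (2 * B)\<^sup>2" for g q
      using power_mono[OF w_bd[of g q], of 2] by simp
    have "avg ltrans2 (w g) q = w g q" for g q
    proof -
      have "avg ltrans2 (\<lambda>q. t (rtrans2 g q)) q = avg ltrans2 t (rtrans2 g q)"
        unfolding avg_def by (simp add: trans2_commute)
      moreover have "avg ltrans2 (w g) q = avg ltrans2 (\<lambda>q. t (rtrans2 g q)) q - avg ltrans2 t q"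
        unfolding w_def by (rule avg_diff[where C = B and C' = B]) (rule bd)+
      ultimately show ?thesis
        by (simp add: fixed w_def)
    qed
    then have w_le: "(cmod (w g p))\<^sup>2 \<le> avg ltrans2 (\<lambda>q. (cmod (w g q))\<^sup>2) p" for g
      using avg_variance[where t = "w g", OF w_bd, of ltrans2 p]
        mean_nonneg[of "\<lambda>i. (cmod (w g (ltrans2 i p) - w g p))\<^sup>2"] by simp
    have "mean (\<lambda>g. (cmod (w g p))\<^sup>2) \<le> mean (\<lambda>g. avg ltrans2 (\<lambda>q. (cmod (w g q))\<^sup>2) p)"
    proof (rule mean_mono)
      have "norm (avg ltrans2 (\<lambda>q. (cmod (w g q))\<^sup>2) p) \<le> (2 * B)\<^sup>2" for g
        by (rule norm_avg_le) (rule w2_bd)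
      then show "bounded (range (\<lambda>g. avg ltrans2 (\<lambda>q. (cmod (w g q))\<^sup>2) p))"
        unfolding bounded_iff by blast
      show "bounded (range (\<lambda>g. (cmod (w g p))\<^sup>2))"
        unfolding bounded_iff using w2_bd by blast
    qed (rule w_le)
    also have "\<dots> = mean (\<lambda>h. mean (\<lambda>g. (cmod (w g (ltrans2 h p)))\<^sup>2))"
      unfolding avg_def by (rule mean_swap) (rule w2_bd)
    also have "\<dots> = avg ltrans2 V p"
      unfolding avg_def V_eq w_def ..
    finally show ?thesis
      unfolding V_eq w_def .
  qed
  \<comment> \<open>The entrywise inequality \<open>V_sub\<close> is summed over column
    \<open>y\<close>.\<close>
  have D_sub: "D y \<le> avg (+) D y" for y
    using V_sub has_sum_mono[OF V_sum weighted_column_sums[of V D C "(+)" y]]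
      V_nonneg V_sum D_le bij_ltrans unfolding ltrans2_def[abs_def] by blast
  have at_0: "(avg (+) ^^ j) D 0 = 0" for j
    by (rule avg_power_defect_eq_0[where F = F and C = C and \<phi> = rtrans])
      (use F_bd D_sub D_nonneg in \<open>auto simp: rtrans_def D_def add.assoc\<close>)
  have D_pow_nonneg: "0 \<le> (avg (+) ^^ j) D z" for j z
    by (induction j arbitrary: z) (simp_all add: D_nonneg avg_def mean_nonneg)
  have D_bd: "norm (D z) \<le> C" for z
    using D_nonneg D_le by simp
  \<comment> \<open>Iterate \<open>Suc j\<close> at \<open>z\<close> is the mean of iterate
    \<open>j\<close> over the points \<open>g + z\<close>, so its vanishing kills all terms of
    nonzero weight. Each step uses up one iterate, which is why all of them are assumed to vanish at
    \<open>z\<close>.\<close>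
  have propagate: "(avg (+) ^^ j) D (g + z) = 0"
    if "\<forall>j. (avg (+) ^^ j) D z = 0" "\<nu> g \<noteq> 0" for g z j
  proof -
    have "norm ((avg (+) ^^ j) D z) \<le> C" for z
      by (rule norm_avg_power_le[where f = D, OF D_bd])
    then have "bounded (range (\<lambda>g. (avg (+) ^^ j) D (g + z)))"
      unfolding bounded_iff by blast
    moreover have "mean (\<lambda>g. (avg (+) ^^ j) D (g + z)) = 0"
      using that(1)[rule_format, of "Suc j"] by (simp add: avg_def)
    ultimately show ?thesis
      using mean_eq_0D[of "\<lambda>g. (avg (+) ^^ j) D (g + z)" g] D_pow_nonneg that(2) by blast
  qed
  define Z where "Z = {z. \<forall>j. (avg (+) ^^ j) D z = 0}"
  \<comment> \<open>Carrying both signs makes the predicate closed under negation; symmetry of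
    \<open>\<nu>\<close> supplies \<open>- g\<close> for \<open>g\<close> in the support.\<close>
  have "(\<forall>z\<in>Z. g + z \<in> Z) \<and> (\<forall>z\<in>Z. - g + z \<in> Z)" for g
  proof (rule subgroup_generated_UNIV_induct[of "{g. \<nu> g \<noteq> 0}"
        "\<lambda>g. (\<forall>z\<in>Z. g + z \<in> Z) \<and> (\<forall>z\<in>Z. - g + z \<in> Z)"])
    show "subgroup_generated {g. \<nu> g \<noteq> 0} = UNIV"
      using gen(2) by (simp add: generating_measure_def)
    show "(\<forall>z\<in>Z. g + z \<in> Z) \<and> (\<forall>z\<in>Z. - g + z \<in> Z)" if "g \<in> {g. \<nu> g \<noteq> 0}" for g
      using that propagate[of _ g] propagate[of _ "- g"] gen(1)
      unfolding Z_def symmetric_measure_def by auto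
    show "(\<forall>z\<in>Z. g + h + z \<in> Z) \<and> (\<forall>z\<in>Z. - (g + h) + z \<in> Z)"
      if "(\<forall>z\<in>Z. g + z \<in> Z) \<and> (\<forall>z\<in>Z. - g + z \<in> Z)"
        "(\<forall>z\<in>Z. h + z \<in> Z) \<and> (\<forall>z\<in>Z. - h + z \<in> Z)" for g h
      using that by (simp add: minus_add add.assoc del: add_uminus_conv_diff)
  qed auto
  moreover have "0 \<in> Z"
    using at_0 by (simp add: Z_def)
  ultimately have "y \<in> Z"
    by (metis add.right_neutral)
  then have "D y = 0"
    unfolding Z_def by (metis (mono_tags) funpow_0 mem_Collect_eq)
  then show ?thesis
    by (simp add: D_def)
qed

text \<open>Right invariance comes first. It makes column \<open>y\<close> a row permutation of
  column \<open>0\<close>, so \<open>F\<close> is constant, hence harmonic for left translations,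
  and the same variance argument gives left invariance.\<close>

lemma translation_invariant:
  fixes t :: "'g \<times> 'g \<Rightarrow> complex"
  assumes bd: "\<And>p. cmod (t p) \<le> B"
    and sums: "\<And>y. ((\<lambda>x. (cmod (t (x, y)))\<^sup>2) has_sum F y) UNIV" "\<And>y. F y \<le> C"
    and fixed: "avg rtrans2 t = t" "avg ltrans2 t = t"
    and gen: "symmetric_measure \<nu>" "generating_measure \<nu>"
  shows "t (x + g, y + g) = t (x, y)" "t (g + x, g + y) = t (x, y)"
proof -
  have gen': "subgroup_generated {g. \<nu> g \<noteq> 0} = UNIV"
    using gen(2) by (simp add: generating_measure_def)
  have "t (rtrans g x, rtrans g y) = t (x, y)" if "\<nu> g \<noteq> 0" for g x y
    by (rule invariant_if_column_sums_harmonic[OF bd sums bij_rtrans _ right_defect_eq_0 that])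
      (use assms in \<open>auto simp: rtrans2_def[abs_def]\<close>)
  then have r: "t (x + g, y + g) = t (x, y)" if "\<nu> g \<noteq> 0" for g x y
    using that by (simp add: rtrans_def)
  have "\<forall>x y. t (x + g, y + g) = t (x, y)" for g
  proof (rule subgroup_generated_UNIV_induct[OF gen', of
          "\<lambda>g. \<forall>x y. t (x + g, y + g) = t (x, y)"])
    show "\<forall>x y. t (x + - g, y + - g) = t (x, y)" if "\<forall>x y. t (x + g, y + g) = t (x, y)" for g
      using that[rule_format, of "_ - g" "_ - g"] by (intro allI) simp
  qed (auto simp: r simp flip: add.assoc)
  then show right: "t (x + g, y + g) = t (x, y)" for x y g
    by blast
  have "F y = F 0" for y
  proof -
    have "((\<lambda>x. (cmod (t (rtrans y x, y)))\<^sup>2) has_sum F y) UNIV"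
      using has_sum_reindex_bij_betw[OF bij_rtrans, THEN iffD2, OF sums(1)] .
    moreover have "t (rtrans y x, y) = t (x, 0)" for x
      using right[of x y 0] by (simp add: rtrans_def)
    ultimately show ?thesis
      using has_sum_unique[OF _ sums(1)[of 0]] by simp
  qed
  then have F_const: "F = (\<lambda>_. F 0)"
    by blast
  have "avg (+) F y = F y" for y
    by (subst (1 2) F_const) (simp add: avg_def)
  then have l: "t (g + x, g + y) = t (x, y)" if "\<nu> g \<noteq> 0" for g x y
    by (intro invariant_if_column_sums_harmonic[OF bd sums bij_ltrans _ _ that])
      (use fixed in \<open>auto simp: ltrans2_def[abs_def]\<close>)
  have "\<forall>x y. t (g + x, g + y) = t (x, y)" for g
  proof (rule subgroup_generated_UNIV_induct[OF gen', of
          "\<lambda>g. \<forall>x y. t (g + x, g + y) = t (x, y)"])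
    show "\<forall>x y. t (- g + x, - g + y) = t (x, y)" if "\<forall>x y. t (g + x, g + y) = t (x, y)" for g
      using that[rule_format, of "- g + _" "- g + _"] by (intro allI) simp
  qed (auto simp: l add.assoc)
  then show "t (g + x, g + y) = t (x, y)"
    by blast
qed

section \<open>The operators on kernels as averages over index pairs\<close>

lemma P_nu_eq_avg: "P_nu \<nu> T x y = avg rtrans2 (case_prod T) (x, y)"
  by (simp add: P_nu_def avg_def mean_def rtrans2_def rtrans_def scaleR_conv_of_real)

lemma Po_nu_eq_avg: "Po_nu \<nu> T x y = avg ltrans2 (case_prod T) (x, y)"
  by (simp add: Po_nu_def avg_def mean_def ltrans2_def scaleR_conv_of_real)

lemma P_nu_fixed_iff: "P_nu \<nu> T = T \<longleftrightarrow> avg rtrans2 (case_prod T) = case_prod T"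
  by (auto simp: fun_eq_iff P_nu_eq_avg)

lemma Po_nu_fixed_iff: "Po_nu \<nu> T = T \<longleftrightarrow> avg ltrans2 (case_prod T) = case_prod T"
  by (auto simp: fun_eq_iff Po_nu_eq_avg)

lemma P_nu_Po_nu_fixed_iff:
  "P_nu \<nu> (Po_nu \<nu> T) = T \<longleftrightarrow> avg rtrans2 (avg ltrans2 (case_prod T)) = case_prod T"
proof -
  have "case_prod (Po_nu \<nu> T) = avg ltrans2 (case_prod T)"
    by (auto simp: fun_eq_iff Po_nu_eq_avg)
  then have "P_nu \<nu> (Po_nu \<nu> T) x y = avg rtrans2 (avg ltrans2 (case_prod T)) (x, y)" for x y
    by (simp add: P_nu_eq_avg)
  then show ?thesis
    by (auto simp: fun_eq_iff)
qed

end

section \<open>Bounded kernels and the center of the group von Neumann algebra\<close>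

lemma bounded_kernel_columns:
  assumes "bounded_kernel T"
  obtains C where "\<And>y. (\<lambda>x. (cmod (T x y))\<^sup>2) summable_on UNIV"
    "\<And>y. (\<Sum>\<^sub>\<infinity>x. (cmod (T x y))\<^sup>2) \<le> C"
proof -
  obtain C where C: "\<And>f. finite {y. f y \<noteq> 0} \<Longrightarrow>
      (\<lambda>x. (cmod (\<Sum>y\<in>{y. f y \<noteq> 0}. T x y * f y))\<^sup>2) summable_on UNIV \<and>
      (\<Sum>\<^sub>\<infinity>x. (cmod (\<Sum>y\<in>{y. f y \<noteq> 0}. T x y * f y))\<^sup>2) \<le> C * l2norm_sq f"
    using assms unfolding bounded_kernel_def by blast
  have *: "(\<lambda>x. (cmod (T x z))\<^sup>2) summable_on UNIV \<and> (\<Sum>\<^sub>\<infinity>x. (cmod (T x z))\<^sup>2) \<le> C" for z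
  proof -
    \<comment> \<open>Testing with the unit vector at \<open>z\<close> turns the operator bound into
      a bound on column \<open>z\<close>.\<close>
    define f :: "_ \<Rightarrow> complex" where "f y = (if y = z then 1 else 0)" for y
    have supp: "{y. f y \<noteq> 0} = {z}"
      by (auto simp: f_def)
    have "l2norm_sq f = (\<Sum>\<^sub>\<infinity>y\<in>{z}. (cmod (f y))\<^sup>2)"
      unfolding l2norm_sq_def by (rule infsum_cong_neutral) (auto simp: f_def)
    then show ?thesis
      using C[of f] unfolding supp by (simp add: f_def)
  qed
  show thesis
    by (rule that[of C]) (use * in auto)
qed

lemma infsum_single:
  assumes "\<And>x. x \<noteq> a \<Longrightarrow> f x = 0"
  shows "infsum f UNIV = f a"
proof -
  have "infsum f UNIV = infsum f {a}"
    by (rule infsum_cong_neutral) (use assms in auto)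
  then show ?thesis
    by simp
qed

lemma kcomp_lambda_right: "kcomp A (lambda_op g) x z = A x (g + z)"
  unfolding kcomp_def lambda_op_def by (subst infsum_single[of "g + z"]) auto

lemma kcomp_lambda_left: "kcomp (lambda_op g) A x z = A (- g + x) z"
  unfolding kcomp_def lambda_op_def
  by (subst infsum_single[of "- g + x"]) (auto simp: add.assoc[symmetric])

text \<open>Multiplication by the permutation matrix \<open>lambda_op g\<close> only shifts one
  index.\<close>

lemma in_commutant_lambda_iff:
  "A \<in> commutant (range lambda_op) \<longleftrightarrow>
    bounded_kernel A \<and> (\<forall>g x z. A (g + x) (g + z) = A x z)"
proof -
  have "(\<forall>g. kcomp A (lambda_op g) = kcomp (lambda_op g) A) \<longleftrightarrow>
      (\<forall>g x z. A x (g + z) = A (- g + x) z)"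
    by (simp add: fun_eq_iff kcomp_lambda_left kcomp_lambda_right)
  also have "\<dots> \<longleftrightarrow> (\<forall>g x z. A (g + x) (g + z) = A x z)"
  proof (intro iffI allI)
    show "A (g + x) (g + z) = A x z" if "\<forall>g x z. A x (g + z) = A (- g + x) z" for g x z
      using that[rule_format, of "g + x" g z] by simp
    show "A x (g + z) = A (- g + x) z" if "\<forall>g x z. A (g + x) (g + z) = A x z" for g x z
      using that[rule_format, of g "- g + x" z] by simp
  qed
  finally show ?thesis
    by (auto simp: commutant_def)
qed

text \<open>The substitution \<open>y \<mapsto> x - y + z\<close> matches the two convolution sums term by term.\<close>
lemma kcomp_commute_if_invariant:
  fixes T A :: "'g::group_add \<Rightarrow> 'g \<Rightarrow> complex"
  assumes T: "\<And>x y g. T (x + g) (y + g) = T x y" "\<And>x y g. T (g + x) (g + y) = T x y"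
    and A: "\<And>x y g. A (g + x) (g + y) = A x y"
  shows "kcomp T A = kcomp A T"
proof (intro ext)
  fix x z :: 'g
  have cancel: "a - (b - c + a) + b = c" for a b c :: 'g
    by (simp only: diff_conv_add_uminus minus_add minus_minus add.assoc minus_add_cancel
        add_minus_cancel left_minus add_0_right)
  have bij: "bij (\<lambda>y. x - y + z)"
    by (rule bij_betwI[of _ _ _ "\<lambda>y. z - y + x"])
      (simp_all only: cancel, auto)
  have "A x (x - y + z) * T (x - y + z) z = T x y * A y z" for y
  proof -
    have "y - x + (x - y + z) = z"
      by (simp only: diff_conv_add_uminus add.assoc minus_add_cancel add_minus_cancel)
    \<comment> \<open>Left translation by \<open>y - x\<close> carries the first index pair to the
      second.\<close>
    then have "A x (x - y + z) = A y z"
      using A[of "y - x" x "x - y + z"] by simp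
    \<comment> \<open>Right translations bring both entries to \<open>T (x - y) 0\<close>.\<close>
    moreover have "T (x - y + z) z = T x y"
      using T(1)[of "x - y" z 0] T(1)[of x "- y" y] by simp
    ultimately show ?thesis
      by simp
  qed
  then show "kcomp T A x z = kcomp A T x z"
    unfolding kcomp_def using infsum_reindex_bij_betw[OF bij, of "\<lambda>y. A x y * T y z"] by simp
qed

text \<open>Left invariance puts \<open>T\<close> in the commutant of the
  \<open>lambda_op g\<close>, so all of \<open>group_vNa\<close> commutes with \<open>T\<close>.
  Commuting with that whole commutant puts \<open>T\<close> itself in
  \<open>group_vNa\<close>.\<close>

lemma in_center_if_invariant:
  assumes "bounded_kernel T"
    and "\<And>x y g. T (x + g) (y + g) = T x y" "\<And>x y g. T (g + x) (g + y) = T x y"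
  shows "T \<in> center group_vNa"
proof -
  have T: "T \<in> commutant (range lambda_op)"
    using assms(1,3) by (simp add: in_commutant_lambda_iff)
  have "kcomp T A = kcomp A T" if "A \<in> commutant (range lambda_op)" for A
    by (rule kcomp_commute_if_invariant[where T = T, OF assms(2,3)])
      (use that in \<open>simp add: in_commutant_lambda_iff\<close>)
  then have "T \<in> group_vNa"
    using assms(1) by (simp add: group_vNa_def commutant_def[of "commutant _"])
  moreover have "kcomp T A = kcomp A T" if "A \<in> group_vNa" for A
    using that T unfolding group_vNa_def commutant_def[of "commutant _"] by auto
  ultimately show ?thesis
    by (simp add: center_def)
qed

theorem theorem3p2:
  fixes \<nu> :: "'g::{group_add, countable} \<Rightarrow> real"
    and T :: "'g \<Rightarrow> 'g \<Rightarrow> complex"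
  assumes "prob_measure_on \<nu>"
    and "\<nu> 0 > 0"
    and "bounded_kernel T"
    and "P_nu \<nu> (Po_nu \<nu> T) = T"
  shows "P_nu \<nu> T = T \<and> Po_nu \<nu> T = T \<and>
    (symmetric_measure \<nu> \<and> generating_measure \<nu> \<longrightarrow> T \<in> center group_vNa)"
proof -
  interpret group_prob_weights \<nu>
    using assms(1) by unfold_locales
  obtain C where C: "\<And>y. (\<lambda>x. (cmod (T x y))\<^sup>2) summable_on UNIV"
    "\<And>y. (\<Sum>\<^sub>\<infinity>x. (cmod (T x y))\<^sup>2) \<le> C"
    using bounded_kernel_columns[OF assms(3)] by blast
  have bd: "cmod (case_prod T p) \<le> sqrt C" for p
  proof -
    obtain x y where p: "p = (x, y)"
      by (cases p)
    have "(cmod (T x y))\<^sup>2 \<le> (\<Sum>\<^sub>\<infinity>x. (cmod (T x y))\<^sup>2)"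
      by (rule has_sum_mono2[OF has_sum_finiteI has_sum_infsum[OF C(1)], of "{x}"]) auto
    then show ?thesis
      using order_trans[OF _ C(2)] by (simp add: p real_le_rsqrt)
  qed
  \<comment> \<open>The index \<open>k = 0\<close> is admissible: \<open>ltrans2 0\<close> is the
    identity and \<open>\<nu> 0 > 0\<close>.\<close>
  have fixed: "avg rtrans2 (case_prod T) = case_prod T" "avg ltrans2 (case_prod T) = case_prod T"
    using avg_fixed_if_fixed_by_product[where f = "case_prod T" and \<phi> = rtrans2 and \<psi> = ltrans2
        and k = 0, OF bd trans2_commute] assms(2,4)
    by (auto simp: P_nu_Po_nu_fixed_iff ltrans2_def)
  have "T \<in> center group_vNa" if gen: "symmetric_measure \<nu>" "generating_measure \<nu>"
  proof (rule in_center_if_invariant[OF assms(3)])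
    have sums: "((\<lambda>x. (cmod (case_prod T (x, y)))\<^sup>2) has_sum (\<Sum>\<^sub>\<infinity>x. (cmod (T x y))\<^sup>2)) UNIV" for y
      using has_sum_infsum[OF C(1)] by simp
    note inv = translation_invariant[OF bd sums C(2) fixed gen]
    show "T (x + g) (y + g) = T x y" "T (g + x) (g + y) = T x y" for x y g
      using inv(1)[of x g y] inv(2)[of g x y] by auto
  qed
  then show ?thesis
    using fixed by (simp add: P_nu_fixed_iff Po_nu_fixed_iff)
qed

end
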